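(* For each $n\ge 1$ let $(a_1,\dots,a_n)$ be a uniformly random permutation of $\{1,\dots,n\}$ (i.e. uniformly distributed among the $n!$ arrangements of $1,\dots,n$), and let $\pi=(n\ a_n)\cdots(2\ a_2)(1\ a_1)$. Then for each $k\ge 0$ the probability that $\pi$ has exactly $k$ fixed points converges, as $n\to\infty$, to a limit $\bar p_k$, and these limits are given by $$\sum_{k\ge 0}\bar p_k u^k=\bar q(u),\qquad \bar q(u)=\exp\Bigl(\tfrac12(u-1)(u+4e-7)\Bigr).$$
   Context: Permutations are composed from right to left; $(i\ j)$ denotes the transposition of $\{1,\dots,n\}$ exchanging $i$ and $j$, and $(i\ i)$ denotes the identity. Here $e$ is the base of natural logarithms. *)

theory Defs
  imports "HOL-Combinatorics.Combinatorics" "HOL-Probability.Probability"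
begin

text \<open>
  \<open>transposition_product a n\<close> is \<open>(n a\<^sub>n) \<cdots> (2 a\<^sub>2) (1 a\<^sub>1)\<close>; the factor \<open>(1 a\<^sub>1)\<close> acts first.
  Note that \<open>Transposition.transpose i i = id\<close>.
\<close>

primrec transposition_product :: "(nat \<Rightarrow> nat) \<Rightarrow> nat \<Rightarrow> nat \<Rightarrow> nat" where
  "transposition_product a 0 = id"
| "transposition_product a (Suc n) =
     Transposition.transpose (Suc n) (a (Suc n)) \<circ> transposition_product a n"

text \<open>An arrangement \<open>(a\<^sub>1, \<dots>, a\<^sub>n)\<close> is the bijection \<open>i \<mapsto> a\<^sub>i\<close>, extended by the identity.\<close>

definition random_perm :: "nat \<Rightarrow> (nat \<Rightarrow> nat) pmf" where
  "random_perm n = pmf_of_set {a. a permutes {1..n}}"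

definition num_fixpoints :: "nat \<Rightarrow> (nat \<Rightarrow> nat) \<Rightarrow> nat" where
  "num_fixpoints n \<pi> = card {i \<in> {1..n}. \<pi> i = i}"

definition prob_fixpoints :: "nat \<Rightarrow> nat \<Rightarrow> real" where
  "prob_fixpoints n k =
     measure_pmf.prob (random_perm n) {a. num_fixpoints n (transposition_product a n) = k}"

end

theory Submission
  imports Defs "HOL-Complex_Analysis.Complex_Analysis"
begin

text \<open>
  The factors \<open>(i a\<^sub>i)\<close> belonging to one cycle of \<open>a\<close> move only the points of that cycle, so the
  fixed points of the product are decided cycle by cycle. A point \<open>v\<close> is first touched by whichever
  of the factors \<open>v\<close> and \<open>a\<^sup>-\<^sup>1 v\<close> comes earlier, and from then on it is carried along its cycle
  in one direction for as long as the labels it meets increase. It comes back to \<open>v\<close> exactly if the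
  cycle \<open>v, a v, a (a v), \<dots>\<close> is monotone when read from \<open>v\<close>
  (\<open>transposition_product_fixes_iff\<close>).

  Among the \<open>(m - 1)!\<close> cyclic permutations of an \<open>m\<close>-set only the increasing and the decreasing one
  therefore produce fixed points: one each if \<open>m \<ge> 3\<close>, while for \<open>m = 2\<close> they coincide and fix both
  points, and for \<open>m = 1\<close> there is one fixed point. Averaging \<open>u\<close> to the number of fixed points over
  these cyclic permutations gives \<open>f\<^sub>1 = u\<close>, \<open>f\<^sub>2 = u\<^sup>2\<close> and \<open>f\<^sub>m = 1 + 2 (u - 1) / (m - 1)!\<close>
  (\<open>sum_cyclic_perms_weight\<close>). Splitting off the cycle through a given point of a permutation
  of \<open>n\<close> points shows that the probability generating function \<open>Q\<^sub>n(u)\<close> of the number of fixed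
  points satisfies \<open>n Q\<^sub>n = (\<Sum>m = 1..n. f\<^sub>m Q\<^bsub>n-m\<^esub>)\<close> (\<open>sum_permutes_weight\<close>).

  In terms of generating functions in \<open>z\<close> this recurrence says
  \<open>(\<Sum>n. Q\<^sub>n z^n) = exp (G(z)) / (1 - z)\<close> with \<open>G(z) = (\<Sum>m\<ge>1. (f\<^sub>m - 1) z^m / m)\<close>. Since
  \<open>f\<^sub>m - 1\<close> decays like \<open>1 / (m - 1)!\<close>, the function \<open>G\<close> is entire. Division by \<open>1 - z\<close> forms
  partial sums, so \<open>Q\<^sub>n(u)\<close> is a partial sum of the Taylor series of \<open>exp (G(z))\<close> at \<open>z = 1\<close> and
  tends to \<open>exp (G(1))\<close>; the number \<open>e\<close> enters through \<open>(\<Sum>m\<ge>3. 1 / m!) = e - 5/2\<close>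
  (\<open>fixpoint_mean_tendsto\<close>). Finally, pointwise convergence of power series with bounded
  coefficients in the unit disc forces convergence of each coefficient (\<open>coefficient_tendsto\<close>).
\<close>

section \<open>Fixed points of the product and monotone cycles\<close>

lemma transposition_product_stationary:
  assumes "transposition_product a s v = w" "s \<le> r"
    and "\<And>t. s < t \<Longrightarrow> t \<le> r \<Longrightarrow> t \<noteq> w \<and> a t \<noteq> w"
  shows "transposition_product a r v = w"
  using assms(2,3)
proof (induction r rule: dec_induct)
  case base
  then show ?case using assms(1) by simp
next
  case (step r)
  have "transposition_product a r v = w" by (rule step.IH) (use step.prems in auto)
  moreover have "Suc r \<noteq> w" "a (Suc r) \<noteq> w" using step by auto
  ultimately show ?case by (simp add: Transposition.transpose_def)
qed

lemma transposition_product_step: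
  "0 < t \<Longrightarrow> transposition_product a t v =
     Transposition.transpose t (a t) (transposition_product a (t - 1) v)"
  by (cases t) auto

text \<open>
  Apart from the factor with label \<open>y\<close>, the only factor touching the point \<open>a y\<close> is the one with
  label \<open>a y\<close>. So a point that has just been carried to \<open>a y\<close> by factor \<open>y\<close> moves again if and only if
  \<open>a y > y\<close>, and then lands on \<open>a (a y)\<close> at time \<open>a y\<close>: the same situation with \<open>a y\<close> in place
  of \<open>y\<close>. The point thus walks forward along its cycle until the first descent.
\<close>

lemma forward_walk:
  assumes a: "a permutes {1..n}" and "y \<in> {1..n}" "transposition_product a y v = a y"
  shows "\<exists>j. transposition_product a n v = (a ^^ Suc j) y \<and>
             (\<forall>i<j. (a ^^ i) y < (a ^^ Suc i) y) \<and> (a ^^ Suc j) y \<le> (a ^^ j) y"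
  using assms(2,3)
proof (induction "n - y" arbitrary: y rule: less_induct)
  case less
  have inj: "a s = a t \<longleftrightarrow> s = t" for s t
    using permutes_inj[OF a] by (auto dest: injD)
  have ay: "a y \<in> {1..n}" using permutes_in_image[OF a] less.prems(1) by blast
  show ?case
  proof (cases "a y \<le> y")
    case True
    have "transposition_product a n v = a y"
      by (rule transposition_product_stationary[OF less.prems(2)])
         (use less.prems(1) True inj in auto)
    with True show ?thesis by (intro exI[of _ 0]) auto
  next
    case False
    have "transposition_product a (a y - 1) v = a y"
      by (rule transposition_product_stationary[OF less.prems(2)])
         (use False inj in auto)
    hence step: "transposition_product a (a y) v = a (a y)"
      using ay by (simp add: transposition_product_step)
    have "n - a y < n - y" using False ay by auto
    from less.hyps[OF this ay step] obtain j where j: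
      "transposition_product a n v = (a ^^ Suc j) (a y)"
      "\<forall>i<j. (a ^^ i) (a y) < (a ^^ Suc i) (a y)" "(a ^^ Suc j) (a y) \<le> (a ^^ j) (a y)"
      by blast
    have "(a ^^ i) y < (a ^^ Suc i) y" if "i < Suc j" for i
      using that j(2) False by (cases i) (auto simp: funpow_swap1)
    with j(1,3) show ?thesis
      by (intro exI[of _ "Suc j"]) (auto simp: funpow_swap1)
  qed
qed

text \<open>
  The mirror image of \<open>forward_walk\<close>: the factor that carries a point from \<open>a y\<close> to \<open>y\<close> has label \<open>y\<close>,
  and the other factor touching \<open>y\<close> has label \<open>inv a y\<close>.
\<close>

lemma backward_walk:
  assumes a: "a permutes {1..n}" and "y \<in> {1..n}" "transposition_product a y v = y"
  shows "\<exists>j. transposition_product a n v = (inv a ^^ j) y \<and>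
             (\<forall>i<j. (inv a ^^ i) y < (inv a ^^ Suc i) y) \<and> (inv a ^^ Suc j) y \<le> (inv a ^^ j) y"
  using assms(2,3)
proof (induction "n - y" arbitrary: y rule: less_induct)
  case less
  have inv: "a t = y \<longleftrightarrow> t = inv a y" for t y
    using permutes_inv_eq[OF a] by metis
  have iy: "inv a y \<in> {1..n}" using permutes_in_image[OF permutes_inv[OF a]] less.prems(1) by blast
  show ?case
  proof (cases "inv a y \<le> y")
    case True
    have "transposition_product a n v = y"
      by (rule transposition_product_stationary[OF less.prems(2)])
         (use less.prems(1) True inv in auto)
    with True show ?thesis by (intro exI[of _ 0]) auto
  next
    case False
    have "transposition_product a (inv a y - 1) v = y"
      by (rule transposition_product_stationary[OF less.prems(2)])
         (use False inv in auto)
    moreover have "a (inv a y) = y" by (simp add: inv)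
    ultimately have step: "transposition_product a (inv a y) v = inv a y"
      using iy by (simp add: transposition_product_step)
    have "n - inv a y < n - y" using False iy by auto
    from less.hyps[OF this iy step] obtain j where j:
      "transposition_product a n v = (inv a ^^ j) (inv a y)"
      "\<forall>i<j. (inv a ^^ i) (inv a y) < (inv a ^^ Suc i) (inv a y)"
      "(inv a ^^ Suc j) (inv a y) \<le> (inv a ^^ j) (inv a y)"
      by blast
    have "(inv a ^^ i) y < (inv a ^^ Suc i) y" if "i < Suc j" for i
      using that j(2) False by (cases i) (auto simp: funpow_swap1)
    with j(1,3) show ?thesis
      by (intro exI[of _ "Suc j"]) (auto simp: funpow_swap1)
  qed
qed

text \<open>
  The cycle of \<open>a\<close>, read from \<open>v\<close> up to but excluding the step that closes it, is a chain for \<open>R\<close>.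
\<close>

definition monotone_from :: "('a \<Rightarrow> 'a \<Rightarrow> bool) \<Rightarrow> ('a \<Rightarrow> 'a) \<Rightarrow> 'a \<Rightarrow> bool" where
  "monotone_from R a v \<longleftrightarrow> (\<forall>w \<in> orbit a v. a w \<noteq> v \<longrightarrow> R w (a w))"

abbreviation increasing_from :: "(nat \<Rightarrow> nat) \<Rightarrow> nat \<Rightarrow> bool" where
  "increasing_from \<equiv> monotone_from (<)"

abbreviation decreasing_from :: "(nat \<Rightarrow> nat) \<Rightarrow> nat \<Rightarrow> bool" where
  "decreasing_from \<equiv> monotone_from (>)"

lemma monotone_from_orbit:
  assumes "v \<in> orbit a v" "transp R" "monotone_from R a v" "w \<in> orbit a v"
  shows "w = v \<or> R v w"
  using assms(4)
proof induction
  case base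
  then show ?case using assms unfolding monotone_from_def by metis
next
  case (step y)
  then show ?case using assms unfolding monotone_from_def by (metis transpD)
qed

theorem transposition_product_fixes_iff:
  assumes a: "a permutes {1..n}" and v: "v \<in> {1..n}"
  shows "transposition_product a n v = v \<longleftrightarrow> increasing_from a v \<or> decreasing_from a v"
proof -
  have perm: "permutation a" using a by (auto simp: permutation_permutes)
  have inv: "a t = y \<longleftrightarrow> t = inv a y" for t y
    using permutes_inv_eq[OF a] by metis
  have self: "v \<in> orbit a v" by (rule permutation_self_in_orbit) fact
  have invv: "inv a v \<in> orbit a v"
    using orbit_inv_eq[OF perm] orbit.base[of "inv a" v] by simp
  have ainv: "a (inv a y) = y" for y by (simp add: inv)
  \<comment> \<open>The factors touching \<open>v\<close> have the labels \<open>v\<close> and \<open>inv a v\<close>; the smaller label decides in which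
    direction \<open>v\<close> sets out along its cycle.\<close>
  show ?thesis
  proof (cases "v \<le> inv a v")
    case True
    have "transposition_product a (v - 1) v = v"
      by (rule transposition_product_stationary[of _ 0]) (use True inv in auto)
    hence "transposition_product a v v = a v"
      using v by (simp add: transposition_product_step)
    from forward_walk[OF a v this] obtain j where j:
      "transposition_product a n v = (a ^^ Suc j) v"
      "\<And>i. i < j \<Longrightarrow> (a ^^ i) v < (a ^^ Suc i) v" "(a ^^ Suc j) v \<le> (a ^^ j) v"
      by blast
    have "transposition_product a n v = v \<longleftrightarrow> increasing_from a v"
    proof
      assume "transposition_product a n v = v"
      hence ret: "(a ^^ Suc j) v = v" using j(1) by simp
      show "increasing_from a v"
        unfolding monotone_from_def
      proof (intro ballI impI)
        fix w assume w: "w \<in> orbit a v" "a w \<noteq> v"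
        then obtain i where "i < Suc j" "w = (a ^^ i) v"
          using orbit_altdef_bounded[OF ret] by auto
        with w(2) ret j(2)[of i] show "w < a w"
          by (cases "i = j") auto
      qed
    next
      assume inc: "increasing_from a v"
      have "(a ^^ j) v \<in> orbit a v" using self by (rule funpow_in_orbit)
      with inc j(3) show "transposition_product a n v = v"
        unfolding monotone_from_def j(1) by fastforce
    qed
    \<comment> \<open>In a cycle decreasing from \<open>v\<close>, the point \<open>v\<close> is the maximum, so here the cycle is trivial.\<close>
    moreover have "increasing_from a v" if "decreasing_from a v"
    proof -
      have "inv a v = v" using monotone_from_orbit[OF self _ that invv] True by auto
      hence "a v = v" using ainv[of v] by simp
      hence "orbit a v = {v}" by (simp add: orbit_eq_singleton_iff)
      with \<open>a v = v\<close> show ?thesis by (simp add: monotone_from_def)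
    qed
    ultimately show ?thesis by blast
  next
    case False
    have "transposition_product a (inv a v - 1) v = v"
      by (rule transposition_product_stationary[of _ 0]) (use False inv in auto)
    moreover have iv: "inv a v \<in> {1..n}"
      using permutes_in_image[OF permutes_inv[OF a]] v by blast
    ultimately have "transposition_product a (inv a v) v = inv a v"
      using iv by (simp add: transposition_product_step ainv)
    from backward_walk[OF a iv this] obtain j where j:
      "transposition_product a n v = (inv a ^^ Suc j) v"
      "\<And>i. i < j \<Longrightarrow> (inv a ^^ Suc i) v < (inv a ^^ Suc (Suc i)) v"
      "(inv a ^^ Suc (Suc j)) v \<le> (inv a ^^ Suc j) v"
      by (auto simp: funpow_swap1)
    have "transposition_product a n v = v \<longleftrightarrow> decreasing_from a v"
    proof
      assume "transposition_product a n v = v"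
      hence ret: "(inv a ^^ Suc j) v = v" using j(1) by simp
      show "decreasing_from a v"
        unfolding monotone_from_def
      proof (intro ballI impI)
        fix w assume w: "w \<in> orbit a v" "a w \<noteq> v"
        then obtain i where i: "i < Suc j" "w = (inv a ^^ i) v"
          using orbit_altdef_bounded[OF ret] orbit_inv_eq[OF perm, of v] by auto
        show "a w < w"
        proof (cases i)
          case 0
          hence "w = inv a ((inv a ^^ j) v)" using ret i by simp
          hence aw: "a w = (inv a ^^ j) v" by (simp add: ainv)
          show ?thesis
          proof (cases j)
            case 0
            then show ?thesis using w aw by simp
          next
            case (Suc j')
            then show ?thesis using j(2)[of j'] aw ret 0 i by simp
          qed
        next
          case (Suc i')
          hence aw: "a w = (inv a ^^ i') v" using i by (simp add: ainv)
          with w(2) obtain i'' where "i' = Suc i''" by (cases i') auto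
          then show ?thesis using j(2)[of i''] aw i Suc by simp
        qed
      qed
    next
      assume dec: "decreasing_from a v"
      have "(inv a ^^ Suc (Suc j)) v \<in> orbit (inv a) v"
        by (rule funpow_in_orbit) (simp add: orbit_inv_eq[OF perm] self)
      hence "(inv a ^^ Suc (Suc j)) v \<in> orbit a v" by (simp add: orbit_inv_eq[OF perm])
      moreover have "a ((inv a ^^ Suc (Suc j)) v) = (inv a ^^ Suc j) v" by (simp add: ainv)
      ultimately show "transposition_product a n v = v"
        using dec j(3) unfolding monotone_from_def j(1) by fastforce
    qed
    \<comment> \<open>In a cycle increasing from \<open>v\<close>, the point \<open>v\<close> is the minimum.\<close>
    moreover have "\<not> increasing_from a v"
      using monotone_from_orbit[OF self _ _ invv, of "(<)"] False by auto
    ultimately show ?thesis by blast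
  qed
qed

definition starts_monotone_cycle :: "(nat \<Rightarrow> nat) \<Rightarrow> nat \<Rightarrow> bool" where
  "starts_monotone_cycle a v \<longleftrightarrow> increasing_from a v \<or> decreasing_from a v"

lemma monotone_from_cong:
  assumes "v \<in> orbit a v" "\<And>w. w \<in> orbit a v \<Longrightarrow> b w = a w"
  shows "monotone_from R b v \<longleftrightarrow> monotone_from R a v"
proof -
  have "orbit b v = orbit a v" using assms by (rule orbit_cong)
  with assms(2) show ?thesis by (simp add: monotone_from_def)
qed

section \<open>Splitting off the cycle through a point\<close>

definition cyclic_perms :: "'a set \<Rightarrow> ('a \<Rightarrow> 'a) set" where
  "cyclic_perms S = {c. c permutes S \<and> cyclic_on c S}"

lemma finite_cyclic_perms: "finite S \<Longrightarrow> finite (cyclic_perms S)"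
  unfolding cyclic_perms_def by (rule finite_subset[OF _ finite_permutations]) auto

lemma comp_disjoint_permutes:
  assumes "c permutes S" "b permutes T" "S \<inter> T = {}"
  shows "x \<in> S \<Longrightarrow> (c \<circ> b) x = c x" "x \<in> T \<Longrightarrow> (c \<circ> b) x = b x"
proof -
  show "(c \<circ> b) x = c x" if "x \<in> S"
  proof -
    have "x \<notin> T" using that assms(3) by blast
    thus ?thesis using assms(2) by (simp add: permutes_not_in)
  qed
  show "(c \<circ> b) x = b x" if "x \<in> T"
  proof -
    have "b x \<notin> S" using that assms(2,3) by (metis disjoint_iff permutes_in_image)
    thus ?thesis using assms(1) by (simp add: permutes_not_in)
  qed
qed

text \<open>
  A permutation of \<open>A\<close> is uniquely determined by the set \<open>S\<close> of points on its cycle through \<open>x\<close>, its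
  restriction to \<open>S\<close>, which is cyclic, and its restriction to \<open>A - S\<close>, which is arbitrary.
\<close>

lemma sum_permutes_split_cycle:
  fixes \<Phi> :: "('a \<Rightarrow> 'a) \<Rightarrow> 'b :: comm_monoid_add"
  assumes A: "finite A" and x: "x \<in> A"
  shows "(\<Sum>a | a permutes A. \<Phi> a) =
         (\<Sum>S | S \<subseteq> A \<and> x \<in> S. \<Sum>c\<in>cyclic_perms S. \<Sum>b | b permutes (A - S). \<Phi> (c \<circ> b))"
proof -
  let ?P = "{S. S \<subseteq> A \<and> x \<in> S}"
  let ?B = "\<lambda>S. cyclic_perms S \<times> {b. b permutes (A - S)}"
  have fin: "finite S" if "S \<in> ?P" for S using that A by (auto intro: finite_subset)
  have "(\<Sum>S\<in>?P. \<Sum>c\<in>cyclic_perms S. \<Sum>b | b permutes (A - S). \<Phi> (c \<circ> b)) =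
        (\<Sum>S\<in>?P. \<Sum>(c, b)\<in>?B S. \<Phi> (c \<circ> b))"
    by (simp add: sum.cartesian_product)
  also have "\<dots> = (\<Sum>(S, c, b)\<in>Sigma ?P ?B. \<Phi> (c \<circ> b))"
    by (subst sum.Sigma) (use A fin in \<open>auto intro!: finite_cyclic_perms finite_permutations\<close>)
  also have "\<dots> = (\<Sum>a | a permutes A. \<Phi> a)"
  proof (rule sum.reindex_bij_witness[where
      i = "\<lambda>a. (orbit a x, perm_restrict a (orbit a x), perm_restrict a (A - orbit a x))" and
      j = "\<lambda>(S, c, b). c \<circ> b"], goal_cases)
    case (1 p)
    then obtain S c b where p: "p = (S, c, b)" and S: "S \<subseteq> A" "x \<in> S"
      and c: "c permutes S" "cyclic_on c S" and b: "b permutes (A - S)"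
      by (auto simp: cyclic_perms_def)
    have eq: "(c \<circ> b) y = c y" if "y \<in> S" for y
      using comp_disjoint_permutes(1)[OF c(1) b _ that] by blast
    have eq': "(c \<circ> b) y = b y" if "y \<in> A - S" for y
      using comp_disjoint_permutes(2)[OF c(1) b _ that] by blast
    have orb: "orbit (c \<circ> b) x = S"
    proof -
      have cx: "orbit c x = S" by (rule orbit_cyclic_eq3[OF c(2) S(2)])
      have "orbit (c \<circ> b) x = orbit c x"
        by (rule orbit_cong) (use cx S eq in auto)
      with cx show ?thesis by simp
    qed
    have "perm_restrict (c \<circ> b) S = c"
      using eq c(1) by (auto simp: perm_restrict_def fun_eq_iff permutes_not_in)
    moreover have "perm_restrict (c \<circ> b) (A - S) = b"
      using eq' permutes_not_in[OF b] by (fastforce simp: perm_restrict_def fun_eq_iff)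
    ultimately show ?case by (simp add: p orb)
  next
    case (2 p)
    then obtain S c b where p: "p = (S, c, b)" and S: "S \<subseteq> A"
      and c: "c permutes S" and b: "b permutes (A - S)"
      by (auto simp: cyclic_perms_def)
    have "c permutes A" "b permutes A"
      using permutes_subset[OF c S] permutes_subset[OF b] by auto
    then show ?case by (simp add: p permutes_compose)
  next
    case (3 a)
    hence a: "a permutes A" by simp
    have sub: "orbit a x \<subseteq> A" using a x by (rule permutes_orbit_subset)
    have cyc: "cyclic_on a (orbit a x)" using a A by (rule cyclic_on_orbit)
    have "perm_restrict a (orbit a x) \<circ> perm_restrict a (A - orbit a x) = perm_restrict a A"
    proof -
      have "a y \<notin> orbit a x" if "y \<notin> orbit a x" for y
        using cyclic_on_f_in[OF a cyc] that by blast
      with sub permutes_not_in[OF a] show ?thesis by (auto simp: perm_restrict_def fun_eq_iff)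
    qed
    thus ?case using a by simp
  next
    case (4 a)
    hence a: "a permutes A" by simp
    have sub: "orbit a x \<subseteq> A" using a x by (rule permutes_orbit_subset)
    have cyc: "cyclic_on a (orbit a x)" using a A by (rule cyclic_on_orbit)
    have self: "x \<in> orbit a x"
      using a A by (intro permutation_self_in_orbit) (auto simp: permutation_permutes)
    have fin: "finite (orbit a x)" using sub A by (rule finite_subset)
    have "perm_restrict a (orbit a x) permutes orbit a x"
    proof (rule bij_imp_permutes)
      have "inj_on a (orbit a x)" using permutes_inj[OF a] by (rule inj_on_subset) simp
      moreover have "a ` orbit a x \<subseteq> orbit a x" using cyclic_on_inI[OF cyc] by blast
      ultimately have "bij_betw a (orbit a x) (orbit a x)"
        using fin by (simp add: bij_betw_def endo_inj_surj)
      thus "bij_betw (perm_restrict a (orbit a x)) (orbit a x) (orbit a x)"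
        by (subst bij_betw_cong[of _ _ a]) (auto simp: perm_restrict_simps)
    qed (simp add: perm_restrict_simps)
    moreover have "cyclic_on (perm_restrict a (orbit a x)) (orbit a x)"
      using cyc by (simp add: cyclic_on_perm_restrict)
    moreover have "perm_restrict a (A - orbit a x) permutes (A - orbit a x)"
      using a cyc by (rule perm_restrict_diff_cyclic)
    ultimately show ?case using sub self by (auto simp: cyclic_perms_def)
  next
    case (5 p)
    then show ?case by auto
  qed
  finally show ?thesis ..
qed

lemma sum_subsets_containing_by_card:
  fixes \<phi> :: "nat \<Rightarrow> 'b :: comm_semiring_1"
  assumes A: "finite A" and x: "x \<in> A"
  shows "(\<Sum>S | S \<subseteq> A \<and> x \<in> S. \<phi> (card S)) =
         (\<Sum>m = 1..card A. of_nat (card A - 1 choose (m - 1)) * \<phi> m)"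
proof -
  define B where "B = A - {x}"
  have B: "finite B" "x \<notin> B" "card B = card A - 1" using A x by (auto simp: B_def)
  have "(\<Sum>S | S \<subseteq> A \<and> x \<in> S. \<phi> (card S)) = (\<Sum>T\<in>Pow B. \<phi> (Suc (card T)))"
  proof (rule sum.reindex_bij_witness[where i = "insert x" and j = "\<lambda>S. S - {x}"], goal_cases)
    case (5 S)
    hence "finite S" "x \<in> S" using A by (auto intro: finite_subset)
    thus ?case by (simp only: card_Suc_Diff1)
  qed (use x in \<open>auto simp: B_def\<close>)
  also have "\<dots> = (\<Sum>k\<in>{..card B}. \<Sum>T | T \<in> Pow B \<and> card T = k. \<phi> (Suc (card T)))"
    by (rule sum.group[symmetric]) (use B(1) in \<open>auto intro: card_mono\<close>)
  also have "\<dots> = (\<Sum>k\<in>{..card B}. of_nat (card B choose k) * \<phi> (Suc k))"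
    using n_subsets[OF B(1)] by (intro sum.cong) auto
  also have "\<dots> = (\<Sum>m = 1..card A. of_nat (card A - 1 choose (m - 1)) * \<phi> m)"
  proof -
    have "card A > 0" using A x by (auto simp: card_gt_0_iff)
    thus ?thesis
      by (intro sum.reindex_bij_witness[where i = "\<lambda>m. m - 1" and j = Suc]) (auto simp: B(3))
  qed
  finally show ?thesis .
qed

lemma binomial_fact_fact:
  assumes "1 \<le> m" "m \<le> n"
  shows "(n - 1 choose (m - 1)) * fact (m - 1) * fact (n - m) = fact (n - 1)"
proof -
  have "fact (m - 1) * fact (n - 1 - (m - 1)) * (n - 1 choose (m - 1)) = fact (n - 1)"
    using assms by (intro binomial_fact_lemma) auto
  moreover have "n - 1 - (m - 1) = n - m" using assms by auto
  ultimately show ?thesis by (simp add: mult_ac)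
qed

text \<open>
  Counting all permutations of \<open>A\<close> by their cycle through \<open>x\<close> expresses \<open>n!\<close> by the numbers of cyclic
  permutations of the subsets containing \<open>x\<close>. The values \<open>(m - 1)!\<close> satisfy the same identity, every
  size \<open>m\<close> then contributing \<open>(n - 1)!\<close>. By induction the two agree on all proper subsets, hence also
  on \<open>A\<close>.
\<close>

lemma card_cyclic_perms:
  assumes "finite A" "A \<noteq> {}"
  shows "card (cyclic_perms A) = fact (card A - 1)"
  using assms
proof (induction rule: finite_psubset_induct)
  case (psubset A)
  then obtain x where x: "x \<in> A" by auto
  let ?P = "{S. S \<subseteq> A \<and> x \<in> S}" and ?n = "card A"
  have n: "?n > 0" using psubset by (auto simp: card_gt_0_iff)
  have finP: "finite ?P" using psubset.hyps by auto
  have AP: "A \<in> ?P" using x by auto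
  let ?X = "\<Sum>S\<in>?P - {A}. fact (card S - 1) * fact (?n - card S) :: nat"
  have "fact ?n = (\<Sum>a | a permutes A. 1 :: nat)"
    using psubset.hyps by (simp add: card_permutations)
  also have "\<dots> = (\<Sum>S\<in>?P. card (cyclic_perms S) * fact (?n - card S))"
    using psubset.hyps
    by (subst sum_permutes_split_cycle[OF _ x])
       (auto intro!: sum.cong simp: card_permutations card_Diff_subset finite_subset)
  also have "\<dots> = card (cyclic_perms A) + (\<Sum>S\<in>?P - {A}. card (cyclic_perms S) * fact (?n - card S))"
    using finP AP by (simp add: sum.remove[of ?P A])
  also have "(\<Sum>S\<in>?P - {A}. card (cyclic_perms S) * fact (?n - card S)) = ?X"
    by (intro sum.cong refl arg_cong2[where f = "(*)"] psubset.IH) auto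
  finally have 1: "fact ?n = card (cyclic_perms A) + ?X" .
  have "fact (?n - 1) + ?X = (\<Sum>S\<in>?P. fact (card S - 1) * fact (?n - card S))"
    using finP AP by (simp add: sum.remove[of ?P A])
  also have "\<dots> = (\<Sum>m = 1..?n. (?n - 1 choose (m - 1)) * (fact (m - 1) * fact (?n - m)))"
    using sum_subsets_containing_by_card[OF psubset.hyps x, of "\<lambda>m. fact (m - 1) * fact (?n - m) :: nat"]
    by simp
  also have "\<dots> = (\<Sum>m = 1..?n. fact (?n - 1))"
    using binomial_fact_fact[of _ ?n] by (intro sum.cong) (auto simp: mult_ac)
  also have "\<dots> = fact ?n" using n by (simp add: fact_reduce)
  finally show ?case using 1 by simp
qed

section \<open>Monotone cycles on a finite set\<close>

lemma cycle_of_list_nth: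
  assumes "distinct xs" "i < length xs"
  shows "cycle_of_list xs (xs ! i) = xs ! (Suc i mod length xs)"
proof -
  have "cycle_of_list xs (xs ! i) = map (cycle_of_list xs ^^ 1) xs ! i"
    using assms by simp
  also have "\<dots> = rotate 1 xs ! i" using cyclic_rotation[OF assms(1), of 1] by (simp only:)
  also have "\<dots> = xs ! (Suc i mod length xs)" using assms by (simp add: nth_rotate del: rotate_Suc)
  finally show ?thesis .
qed

lemma cycle_of_list_funpow_hd:
  assumes "distinct xs" "i < length xs"
  shows "(cycle_of_list xs ^^ i) (xs ! 0) = xs ! i"
  using assms(2)
  by (induction i) (use cycle_of_list_nth[OF assms(1)] in auto)

lemma cycle_of_list_in_cyclic_perms:
  assumes "distinct xs" "xs \<noteq> []"
  shows "cycle_of_list xs \<in> cyclic_perms (set xs)"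
proof -
  let ?c = "cycle_of_list xs"
  have p: "?c permutes set xs" by (rule cycle_permutes)
  have "set xs \<subseteq> orbit ?c (xs ! 0)"
  proof
    fix y assume "y \<in> set xs"
    then obtain i where "i < length xs" "y = xs ! i" by (auto simp: in_set_conv_nth)
    hence "y = (?c ^^ i) (xs ! 0)" using cycle_of_list_funpow_hd[OF assms(1)] by simp
    thus "y \<in> orbit ?c (xs ! 0)"
      using orbit_altdef_permutation[OF permutation_of_cycle, of xs] by blast
  qed
  moreover have "orbit ?c (xs ! 0) \<subseteq> set xs"
    using assms(2) by (intro permutes_orbit_subset[OF p]) simp
  ultimately have "set xs = orbit ?c (xs ! 0)" by (rule equalityI)
  moreover have "xs ! 0 \<in> set xs" using assms(2) by simp
  ultimately have "cyclic_on ?c (set xs)" by (intro cyclic_on_singleI)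
  with p show ?thesis by (simp add: cyclic_perms_def)
qed

lemma sorted_wrt_set_unique:
  assumes "asymp R" "transp R" "sorted_wrt R xs" "sorted_wrt R ys" "set xs = set ys"
  shows "xs = ys"
  using assms(3-5)
proof (induction xs arbitrary: ys)
  case (Cons x xs)
  obtain y ys' where ys: "ys = y # ys'" using Cons.prems(3) by (cases ys) auto
  have irr: "\<not> R z z" for z using assms(1) by (meson asympD)
  have "x = y \<or> R y x" "x = y \<or> R x y" using Cons.prems ys by auto
  with assms(1) have "x = y" by (auto dest: asympD)
  moreover have "x \<notin> set xs" "y \<notin> set ys'" using Cons.prems ys irr by auto
  hence "set xs = set ys'" using Cons.prems(3) ys \<open>x = y\<close> by auto
  hence "xs = ys'" using Cons.prems ys by (intro Cons.IH) auto
  ultimately show ?case using ys by simp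
qed auto

text \<open>
  Listing the cycle from \<open>v\<close> gives an \<open>R\<close>-sorted enumeration of the set, and there is only one. So a
  finite set carries exactly one cycle that is monotone in a given sense, with only one starting point.
\<close>

lemma monotone_from_cyclic_iff:
  assumes R: "asymp R" "transp R" and xs: "sorted_wrt R xs" "distinct xs" "xs \<noteq> []"
    and c: "c \<in> cyclic_perms (set xs)" and v: "v \<in> set xs"
  shows "monotone_from R c v \<longleftrightarrow> c = cycle_of_list xs \<and> v = hd xs"
proof
  assume mono: "monotone_from R c v"
  have cp: "c permutes set xs" "cyclic_on c (set xs)" using c by (auto simp: cyclic_perms_def)
  hence perm: "permutation c" by (auto simp: permutation_permutes)
  have orb: "orbit c v = set xs" by (rule orbit_cyclic_eq3[OF cp(2) v])
  let ?m = "least_power c v"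
  have m: "?m > 0" using least_power_of_permutation[OF perm] by simp
  have set: "set (support c v) = set xs"
    using support_set[OF perm, of v] orbit_altdef_permutation[OF perm, of v] orb by auto
  have "sorted_wrt R (support c v)"
  proof (subst sorted_wrt_iff_nth_Suc_transp[OF R(2)], intro allI impI)
    fix i assume i: "Suc i < length (support c v)"
    have "(c ^^ Suc i) v \<noteq> v" using least_power_le[where f = c and n = "Suc i" and x = v] i by auto
    moreover have "(c ^^ i) v \<in> orbit c v" using orbit_altdef_permutation[OF perm] by blast
    ultimately have "R ((c ^^ i) v) (c ((c ^^ i) v))" using mono by (auto simp: monotone_from_def)
    with i show "R (support c v ! i) (support c v ! Suc i)" by simp
  qed
  hence supp: "support c v = xs" using sorted_wrt_set_unique[OF R _ xs(1)] set by blast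
  have "hd (support c v) = v" using m by (simp add: hd_map)
  moreover have "c y = cycle_of_list xs y" for y
  proof (cases "y \<in> set xs")
    case True
    thus ?thesis using cycle_restrict[OF perm, of y v] supp by simp
  qed (use cp(1) in \<open>auto simp: id_outside_supp permutes_not_in\<close>)
  ultimately show "c = cycle_of_list xs \<and> v = hd xs" using supp by auto
next
  assume cv: "c = cycle_of_list xs \<and> v = hd xs"
  have "cyclic_on c (set xs)" using c by (simp add: cyclic_perms_def)
  hence orb: "orbit c v = set xs" using v by (rule orbit_cyclic_eq3)
  show "monotone_from R c v"
    unfolding monotone_from_def
  proof (intro ballI impI)
    fix w assume w: "w \<in> orbit c v" "c w \<noteq> v"
    then obtain i where i: "i < length xs" "w = xs ! i"
      unfolding orb in_set_conv_nth by blast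
    have cw: "c w = xs ! (Suc i mod length xs)" using cv i xs by (simp add: cycle_of_list_nth)
    have "Suc i \<noteq> length xs" using w(2) cw cv xs(3) by (auto simp: hd_conv_nth)
    with i have "Suc i < length xs" by simp
    with cw i show "R w (c w)" using sorted_wrt_nth_less[OF xs(1), of i "Suc i"] by simp
  qed
qed

text \<open>
  The mean of \<open>u\<close> to the number of starting points of a monotone reading, over all cyclic permutations
  of a set of \<open>m \<ge> 1\<close> points; see \<open>sum_cyclic_perms_weight\<close>.
\<close>

definition cycle_weight :: "complex \<Rightarrow> nat \<Rightarrow> complex" where
  "cycle_weight u m = (if m = 1 then u else if m = 2 then u ^ 2 else 1 + 2 * (u - 1) / fact (m - 1))"

text \<open>
  The increasing cycle \<open>p\<close> starts at the minimum, the decreasing cycle \<open>q\<close> at the maximum, and every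
  other cyclic permutation has weight \<open>1\<close>. On at most two points there is just one cyclic permutation,
  so \<open>p = q\<close>; from three points on, \<open>p\<close> and \<open>q\<close> send the minimum to different points.
\<close>

lemma sum_cyclic_perms_weight:
  assumes S: "finite S" "S \<noteq> {}"
  shows "(\<Sum>c\<in>cyclic_perms S. u ^ card {v \<in> S. starts_monotone_cycle c v}) =
         fact (card S - 1) * cycle_weight u (card S)"
proof -
  define L where "L = sorted_list_of_set S"
  have L: "set L = S" "sorted_wrt (<) L" "distinct L" "length L = card S" "L \<noteq> []"
    using S by (auto simp: L_def)
  have rL: "sorted_wrt (>) (rev L)" "distinct (rev L)" "rev L \<noteq> []" "set (rev L) = S"
    using L by (auto simp: sorted_wrt_rev)
  define p q where "p = cycle_of_list L" and "q = cycle_of_list (rev L)"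
  have p: "p \<in> cyclic_perms S" using cycle_of_list_in_cyclic_perms[OF L(3,5)] L(1) by (simp add: p_def)
  have q: "q \<in> cyclic_perms S" using cycle_of_list_in_cyclic_perms[OF rL(2,3)] rL(4) by (simp add: q_def)
  have fin: "finite (cyclic_perms S)" using S by (intro finite_cyclic_perms)
  have card: "card (cyclic_perms S) = fact (card S - 1)" using S by (rule card_cyclic_perms)
  have inc: "increasing_from c v \<longleftrightarrow> c = p \<and> v = hd L" if "c \<in> cyclic_perms S" "v \<in> S" for c v
    using monotone_from_cyclic_iff[of "(<)" L c v] that L by (auto simp: p_def asymp_on_def)
  have dec: "decreasing_from c v \<longleftrightarrow> c = q \<and> v = last L" if "c \<in> cyclic_perms S" "v \<in> S" for c v
    using monotone_from_cyclic_iff[of "(>)" "rev L" c v] that rL L(5)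
    by (auto simp: q_def asymp_on_def hd_rev transp_on_def)
  have in_S: "hd L \<in> S" "last L \<in> S" using L by auto
  have starts: "{v \<in> S. starts_monotone_cycle c v} =
      (if c = p then {hd L} else {}) \<union> (if c = q then {last L} else {})"
    if "c \<in> cyclic_perms S" for c
    using inc[OF that] dec[OF that] in_S by (auto simp: starts_monotone_cycle_def)
  have single: "cyclic_perms S = {p}" if "card S \<le> 2"
  proof -
    have "card S - 1 = 0 \<or> card S - 1 = 1" using that by linarith
    hence "card (cyclic_perms S) = 1" using card by auto
    with p show ?thesis by (auto simp: card_1_singleton_iff)
  qed
  have "card S > 0" using S by (simp add: card_gt_0_iff)
  then consider "card S = 1" | "card S = 2" | "card S \<ge> 3" by linarith
  thus ?thesis
  proof cases
    case 1
    hence "hd L = last L" using L(4) by (cases L) auto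
    with 1 single q show ?thesis by (simp add: starts[OF p] cycle_weight_def)
  next
    case 2
    then obtain x y where xy: "L = [x, y]"
      using L(4) by (auto simp: length_Suc_conv numeral_2_eq_2)
    hence "x \<noteq> y" using L(3) by simp
    have "q = p" using 2 single q by auto
    thus ?thesis using 2 single xy \<open>x \<noteq> y\<close> by (simp add: starts[OF p] cycle_weight_def power2_eq_square)
  next
    case 3
    have "p (L ! 0) = L ! 1"
      using cycle_of_list_nth[OF L(3), of 0] L(4) 3 by (simp add: p_def)
    moreover have "q (L ! 0) = L ! (card S - 1)"
      using cycle_of_list_nth[OF rL(2), of "card S - 1"] L(4) 3 by (simp add: q_def rev_nth)
    moreover have "L ! 1 \<noteq> L ! (card S - 1)"
      using L(3,4) 3 by (simp add: nth_eq_iff_index_eq)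
    ultimately have "p \<noteq> q" by auto
    have "(\<Sum>c\<in>cyclic_perms S. u ^ card {v \<in> S. starts_monotone_cycle c v}) =
          (\<Sum>c\<in>cyclic_perms S. 1 + ((if c = p then u - 1 else 0) + (if c = q then u - 1 else 0)))"
      using \<open>p \<noteq> q\<close> by (intro sum.cong refl) (simp add: starts)
    also have "\<dots> = fact (card S - 1) + 2 * (u - 1)"
      using fin p q by (simp add: sum.distrib card)
    also have "\<dots> = fact (card S - 1) * cycle_weight u (card S)"
      using 3 by (simp add: cycle_weight_def field_simps)
    finally show ?thesis .
  qed
qed

section \<open>The recurrence for the generating function\<close>

lemma starts_monotone_cycle_cong:
  assumes "a permutes A" "finite A" "v \<in> A" "\<And>w. w \<in> A \<Longrightarrow> b w = a w"
  shows "starts_monotone_cycle b v = starts_monotone_cycle a v"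
proof -
  have "v \<in> orbit a v"
    using assms(1,2) by (intro permutation_self_in_orbit) (auto simp: permutation_permutes)
  moreover have "b w = a w" if "w \<in> orbit a v" for w
    using permutes_orbit_subset[OF assms(1,3)] that assms(4) by blast
  ultimately have "monotone_from R b v = monotone_from R a v" for R
    by (rule monotone_from_cong)
  thus ?thesis by (simp add: starts_monotone_cycle_def)
qed

text \<open>
  The weight is multiplicative over cycles. Splitting off a cycle of size \<open>m\<close> leaves
  \<open>(n-1 choose m-1) (m-1)! (n-m)! = (n-1)!\<close> times \<open>f\<^sub>m Q\<^bsub>n-m\<^esub>\<close>, whatever the set, so the normalised
  sum depends on the cardinality only and satisfies the recurrence for \<open>Q\<close>.
\<close>

theorem sum_permutes_weight:
  fixes Q :: "nat \<Rightarrow> complex"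
  assumes Q0: "Q 0 = 1"
    and Q_rec: "\<And>n. n > 0 \<Longrightarrow> of_nat n * Q n = (\<Sum>m = 1..n. cycle_weight u m * Q (n - m))"
    and "finite A"
  shows "(\<Sum>a | a permutes A. u ^ card {v \<in> A. starts_monotone_cycle a v}) = fact (card A) * Q (card A)"
  using assms(3)
proof (induction rule: finite_psubset_induct)
  case (psubset A)
  let ?n = "card A"
  show ?case
  proof (cases "A = {}")
    case True
    thus ?thesis by (simp add: Q0)
  next
    case False
    then obtain x where x: "x \<in> A" by auto
    have n: "?n > 0" using psubset.hyps x by (auto simp: card_gt_0_iff)
    let ?w = "\<lambda>a B. u ^ card {v \<in> B. starts_monotone_cycle a v}"
    have "(\<Sum>a | a permutes A. ?w a A) =
          (\<Sum>S | S \<subseteq> A \<and> x \<in> S. \<Sum>c\<in>cyclic_perms S. \<Sum>b | b permutes (A - S). ?w c S * ?w b (A - S))"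
    proof (subst sum_permutes_split_cycle[OF psubset.hyps x], intro sum.cong refl, goal_cases)
      case (1 S c b)
      hence S: "S \<subseteq> A" "finite S" "finite (A - S)" and c: "c permutes S" and b: "b permutes (A - S)"
        using psubset.hyps by (auto simp: cyclic_perms_def intro: finite_subset)
      have "{v \<in> A. starts_monotone_cycle (c \<circ> b) v} =
            {v \<in> S. starts_monotone_cycle (c \<circ> b) v} \<union> {v \<in> A - S. starts_monotone_cycle (c \<circ> b) v}"
        using S by auto
      also have "{v \<in> S. starts_monotone_cycle (c \<circ> b) v} = {v \<in> S. starts_monotone_cycle c v}"
        using starts_monotone_cycle_cong[OF c S(2), of _ "c \<circ> b"] comp_disjoint_permutes(1)[OF c b]
        by auto
      also have "{v \<in> A - S. starts_monotone_cycle (c \<circ> b) v} = {v \<in> A - S. starts_monotone_cycle b v}"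
        using starts_monotone_cycle_cong[OF b S(3), of _ "c \<circ> b"] comp_disjoint_permutes(2)[OF c b]
        by auto
      finally have split: "{v \<in> A. starts_monotone_cycle (c \<circ> b) v} =
          {v \<in> S. starts_monotone_cycle c v} \<union> {v \<in> A - S. starts_monotone_cycle b v}" .
      have "card {v \<in> A. starts_monotone_cycle (c \<circ> b) v} =
          card {v \<in> S. starts_monotone_cycle c v} + card {v \<in> A - S. starts_monotone_cycle b v}"
        unfolding split by (rule card_Un_disjoint) (use S in auto)
      thus ?case by (simp add: power_add)
    qed
    also have "\<dots> = (\<Sum>S | S \<subseteq> A \<and> x \<in> S.
        (\<Sum>c\<in>cyclic_perms S. ?w c S) * (\<Sum>b | b permutes (A - S). ?w b (A - S)))"
      by (simp add: sum_product)
    also have "\<dots> = (\<Sum>S | S \<subseteq> A \<and> x \<in> S. (fact (card S - 1) * cycle_weight u (card S)) *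
        (fact (?n - card S) * Q (?n - card S)))"
    proof (intro sum.cong refl arg_cong2[where f = "(*)"], goal_cases)
      case (1 S)
      thus ?case using psubset.hyps by (intro sum_cyclic_perms_weight) (auto intro: finite_subset)
    next
      case (2 S)
      hence "A - S \<subset> A" "card (A - S) = ?n - card S"
        using psubset.hyps by (auto simp: card_Diff_subset finite_subset)
      thus ?case using psubset.IH[of "A - S"] by simp
    qed
    also have "\<dots> = (\<Sum>m = 1..?n. of_nat (?n - 1 choose (m - 1)) *
        ((fact (m - 1) * cycle_weight u m) * (fact (?n - m) * Q (?n - m))))"
      by (rule sum_subsets_containing_by_card[OF psubset.hyps x])
    also have "\<dots> = (\<Sum>m = 1..?n. fact (?n - 1) * (cycle_weight u m * Q (?n - m)))"
    proof (intro sum.cong refl)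
      fix m assume "m \<in> {1..?n}"
      hence "of_nat ((?n - 1 choose (m - 1)) * fact (m - 1) * fact (?n - m)) = (of_nat (fact (?n - 1)) :: complex)"
        by (subst binomial_fact_fact) auto
      hence "(fact (?n - 1) :: complex) = of_nat (?n - 1 choose (m - 1)) * fact (m - 1) * fact (?n - m)"
        by simp
      thus "of_nat (?n - 1 choose (m - 1)) *
          ((fact (m - 1) * cycle_weight u m) * (fact (?n - m) * Q (?n - m))) =
          fact (?n - 1) * (cycle_weight u m * Q (?n - m))"
        by (simp only: mult_ac)
    qed
    also have "\<dots> = fact (?n - 1) * (of_nat ?n * Q ?n)"
      by (simp only: Q_rec[OF n] sum_distrib_left)
    also have "\<dots> = fact ?n * Q ?n" using n by (simp add: fact_reduce)
    finally show ?thesis .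
  qed
qed

section \<open>Solving the recurrence by an entire function\<close>

text \<open>
  Closed form of \<open>\<Sum>m\<ge>1. (cycle_weight u m - 1) * z ^ m / m\<close>: the first two summands come from the
  exceptional sizes \<open>1\<close> and \<open>2\<close>, the last one is the exponential series from \<open>z ^ 3\<close> on.
\<close>

definition cycle_log :: "complex \<Rightarrow> complex \<Rightarrow> complex" where
  "cycle_log u z = (u - 1) * z + (u ^ 2 - 1) * z ^ 2 / 2 + 2 * (u - 1) * (exp z - 1 - z - z ^ 2 / 2)"

text \<open>
  The generating function in \<open>z\<close> of the differences of consecutive probability generating functions:
  subtracting \<open>1\<close> from every \<open>cycle_weight\<close> removes the factor \<open>1 / (1 - z)\<close>.
\<close>

definition excess_fps :: "complex \<Rightarrow> complex fps" where
  "excess_fps u = fps_expansion (\<lambda>z. exp (cycle_log u z)) 0"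

lemma holomorphic_exp_cycle_log: "(\<lambda>z. exp (cycle_log u z)) holomorphic_on A"
  unfolding cycle_log_def by (intro holomorphic_intros) auto

lemma has_fps_expansion_excess: "(\<lambda>z. exp (cycle_log u z)) has_fps_expansion excess_fps u"
  unfolding excess_fps_def
  by (rule has_fps_expansion_fps_expansion[of UNIV]) (auto intro: holomorphic_exp_cycle_log)

lemma excess_fps_nth_0: "fps_nth (excess_fps u) 0 = 1"
  using has_fps_expansion_imp_0_eq_fps_nth_0[OF has_fps_expansion_excess[of u]]
  by (simp add: cycle_log_def)

text \<open>
  The chain rule for \<open>exp (cycle_log u z)\<close>: the Taylor coefficients of the derivative of
  \<open>cycle_log u\<close> are the numbers \<open>cycle_weight u (Suc k) - 1\<close>.
\<close>

lemma fps_deriv_excess: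
  "fps_deriv (excess_fps u) = Abs_fps (\<lambda>k. cycle_weight u (Suc k) - 1) * excess_fps u"
proof -
  define K where "K = fps_const (u - 1) + fps_const (u ^ 2 - 1) * fps_X +
    fps_const (2 * (u - 1)) * (fps_exp 1 - 1 - fps_X)"
  let ?k = "\<lambda>z. (u - 1) + (u ^ 2 - 1) * z + 2 * (u - 1) * (exp z - 1 - z)"
  have "deriv (\<lambda>z. exp (cycle_log u z)) has_fps_expansion fps_deriv (excess_fps u)"
    by (rule has_fps_expansion_deriv[OF has_fps_expansion_excess])
  moreover have "deriv (\<lambda>z. exp (cycle_log u z)) = (\<lambda>z. ?k z * exp (cycle_log u z))"
  proof (intro ext DERIV_imp_deriv)
    fix z
    have "(cycle_log u has_field_derivative ?k z) (at z)"
      unfolding cycle_log_def by (rule derivative_eq_intros refl | simp)+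
    thus "((\<lambda>z. exp (cycle_log u z)) has_field_derivative ?k z * exp (cycle_log u z)) (at z)"
      by (rule DERIV_fun_exp[THEN DERIV_cong]) simp
  qed
  moreover have "(\<lambda>z. ?k z * exp (cycle_log u z)) has_fps_expansion K * excess_fps u"
    unfolding K_def by (intro fps_expansion_intros has_fps_expansion_excess)
  ultimately have "fps_deriv (excess_fps u) = K * excess_fps u"
    using fps_expansion_unique_complex by metis
  also have "K = Abs_fps (\<lambda>k. cycle_weight u (Suc k) - 1)"
    by (rule fps_ext) (auto simp: K_def cycle_weight_def fps_X_def field_simps)
  finally show ?thesis .
qed

text \<open>
  The mean of \<open>u\<close> to the number of fixed points for permutations of \<open>n\<close> points, as
  \<open>prob_fixpoints_sums\<close> shows; the definition as a partial sum makes the limit evident.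
\<close>

definition fixpoint_mean :: "complex \<Rightarrow> nat \<Rightarrow> complex" where
  "fixpoint_mean u n = (\<Sum>k\<le>n. fps_nth (excess_fps u) k)"

lemma fixpoint_mean_0: "fixpoint_mean u 0 = 1"
  by (simp add: fixpoint_mean_def excess_fps_nth_0)

text \<open>
  With \<open>J = 1 / (1 - z)\<close> the generating function \<open>W\<close> of \<open>fixpoint_mean u\<close> is the excess series
  times \<open>J\<close>. As \<open>J' = J\<^sup>2\<close>, its logarithmic derivative is \<open>K + J\<close>, which has the coefficients
  \<open>cycle_weight u (Suc k)\<close>.
\<close>

lemma fixpoint_mean_rec:
  assumes "n > 0"
  shows "of_nat n * fixpoint_mean u n = (\<Sum>m = 1..n. cycle_weight u m * fixpoint_mean u (n - m))"
proof -
  define J :: "complex fps" where "J = Abs_fps (\<lambda>_. 1)"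
  define K where "K = Abs_fps (\<lambda>k. cycle_weight u (Suc k) - 1)"
  define W where "W = Abs_fps (fixpoint_mean u)"
  obtain n' where n': "n = Suc n'" using assms by (cases n) auto
  have W: "W = excess_fps u * J"
    by (rule fps_ext) (simp add: W_def J_def fixpoint_mean_def fps_mult_nth atLeast0AtMost)
  have "fps_deriv J = J * J"
    by (rule fps_ext) (simp add: J_def fps_mult_nth)
  hence "fps_deriv W = (K + J) * W"
    unfolding W by (simp add: fps_deriv_excess K_def[symmetric] algebra_simps)
  hence "fps_nth (fps_deriv W) n' = fps_nth ((K + J) * W) n'" by simp
  hence "of_nat n * fixpoint_mean u n = (\<Sum>i = 0..n'. cycle_weight u (Suc i) * fixpoint_mean u (n' - i))"
    by (simp add: n' W_def K_def J_def fps_mult_nth)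
  also have "\<dots> = (\<Sum>m = 1..n. cycle_weight u m * fixpoint_mean u (n - m))"
    by (rule sum.reindex_bij_witness[of _ "\<lambda>m. m - 1" Suc]) (auto simp: n')
  finally show ?thesis .
qed

lemma fixpoint_mean_tendsto:
  "fixpoint_mean u \<longlonglongrightarrow> exp (1 / 2 * (u - 1) * (u + 4 * of_real (exp 1) - 7))"
proof -
  have "(\<lambda>n. fps_nth (excess_fps u) n * 1 ^ n) sums exp (cycle_log u 1)"
    by (rule has_fps_expansion_imp_sums_complex[OF has_fps_expansion_excess, where r = \<infinity>])
       (auto intro: holomorphic_exp_cycle_log)
  moreover have "cycle_log u 1 = 1 / 2 * (u - 1) * (u + 4 * of_real (exp 1) - 7)"
    by (simp add: cycle_log_def exp_of_real[symmetric] field_simps power2_eq_square)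
  ultimately show ?thesis by (simp add: sums_def_le fixpoint_mean_def[abs_def])
qed

section \<open>The law of the number of fixed points\<close>

lemma num_fixpoints_transposition_product:
  assumes "a permutes {1..n}"
  shows "num_fixpoints n (transposition_product a n) = card {v \<in> {1..n}. starts_monotone_cycle a v}"
  unfolding num_fixpoints_def starts_monotone_cycle_def
  using transposition_product_fixes_iff[OF assms] by (metis (no_types, lifting))

lemma prob_fixpoints_eq:
  "prob_fixpoints n k =
     card {a. a permutes {1..n} \<and> num_fixpoints n (transposition_product a n) = k} / fact n"
proof -
  have "{a. a permutes {1..n}} \<noteq> {}" using permutes_id by blast
  moreover have "finite {a. a permutes {1..n}}" by (rule finite_permutations) simp
  ultimately show ?thesis
    unfolding prob_fixpoints_def random_perm_def
    by (simp add: measure_pmf_of_set card_permutations Int_def)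
qed

lemma prob_fixpoints_sums:
  "(\<lambda>k. of_real (prob_fixpoints n k) * u ^ k) sums fixpoint_mean u n"
proof -
  let ?P = "{a. a permutes {1..n}}"
  let ?N = "\<lambda>a. num_fixpoints n (transposition_product a n)"
  have fin: "finite ?P" by (rule finite_permutations) simp
  have bound: "?N a \<le> n" for a
  proof -
    have "?N a \<le> card {1..n}" unfolding num_fixpoints_def by (rule card_mono) auto
    thus ?thesis by simp
  qed
  have "fact n * fixpoint_mean u n = (\<Sum>a\<in>?P. u ^ ?N a)"
    using sum_permutes_weight[of "fixpoint_mean u" u "{1..n}", OF fixpoint_mean_0 fixpoint_mean_rec]
    by (simp add: num_fixpoints_transposition_product)
  also have "\<dots> = (\<Sum>k\<le>n. \<Sum>a | a \<in> ?P \<and> ?N a = k. u ^ ?N a)"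
    using fin bound by (intro sum.group[symmetric]) auto
  also have "\<dots> = (\<Sum>k\<le>n. fact n * (of_real (prob_fixpoints n k) * u ^ k))"
    by (intro sum.cong refl) (simp add: prob_fixpoints_eq)
  also have "\<dots> = fact n * (\<Sum>k\<le>n. of_real (prob_fixpoints n k) * u ^ k)"
    by (simp add: sum_distrib_left)
  finally have "fixpoint_mean u n = (\<Sum>k\<le>n. of_real (prob_fixpoints n k) * u ^ k)" by simp
  moreover have "prob_fixpoints n k = 0" if "k \<notin> {..n}" for k
  proof -
    have "{a. a permutes {1..n} \<and> ?N a = k} = {}" using bound that by auto
    thus ?thesis by (simp only: prob_fixpoints_eq card.empty of_nat_0 div_0)
  qed
  ultimately show ?thesis
    using sums_finite[of "{..n}" "\<lambda>k. of_real (prob_fixpoints n k) * u ^ k"] by simp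
qed

section \<open>Convergence of coefficients\<close>

text \<open>
  By induction on \<open>k\<close>, removing the first \<open>k\<close> terms and dividing by \<open>u ^ k\<close> preserves the pointwise
  convergence. For \<open>norm u \<le> 1 / 2\<close> what remains is within \<open>2 * norm u\<close> of its constant term \<open>a n k\<close>,
  uniformly in \<open>n\<close> because of the common bound on the coefficients, so \<open>u\<close> may be taken small before
  \<open>n\<close> large.
\<close>

lemma coefficient_tendsto:
  fixes a :: "nat \<Rightarrow> nat \<Rightarrow> complex" and b :: "nat \<Rightarrow> complex"
  assumes bound: "\<And>n k. norm (a n k) \<le> 1"
    and A: "\<And>n u. norm u < 1 \<Longrightarrow> (\<lambda>k. a n k * u ^ k) sums A n u"
    and B: "\<And>u. norm u < 1 \<Longrightarrow> (\<lambda>k. b k * u ^ k) sums B u"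
    and lim: "\<And>u. norm u < 1 \<Longrightarrow> (\<lambda>n. A n u) \<longlonglongrightarrow> B u"
  shows "(\<lambda>n. a n k) \<longlonglongrightarrow> b k"
proof (induction k rule: less_induct)
  case (less k)
  define A' where "A' n u = (A n u - (\<Sum>j<k. a n j * u ^ j)) / u ^ k" for n u
  define B' where "B' u = (B u - (\<Sum>j<k. b j * u ^ j)) / u ^ k" for u
  have shift: "(\<lambda>j. c (j + k) * u ^ j) sums ((s - (\<Sum>j<k. c j * u ^ j)) / u ^ k)"
    if "(\<lambda>j. c j * u ^ j) sums s" "u \<noteq> 0" for c :: "nat \<Rightarrow> complex" and u s
    using sums_divide[OF sums_split_initial_segment[OF that(1), of k], of "u ^ k"] that(2)
    by (simp add: power_add)
  have close: "norm (A' n u - a n k) \<le> 2 * norm u" if u: "u \<noteq> 0" "norm u \<le> 1 / 2" for n u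
  proof -
    have "(\<lambda>j. a n (j + k) * u ^ j) sums A' n u"
      unfolding A'_def by (rule shift[OF A]) (use u in auto)
    hence "(\<lambda>j. a n (Suc j + k) * u ^ Suc j) sums (A' n u - a n k)"
      by (subst sums_Suc_iff) simp
    moreover have "(\<lambda>j. norm u * norm u ^ j) sums (norm u * (1 / (1 - norm u)))"
      using u by (intro sums_mult geometric_sums) auto
    moreover have "norm (a n (Suc j + k) * u ^ Suc j) \<le> norm u * norm u ^ j" for j
      using mult_right_mono[OF bound[of n "Suc j + k"], of "norm u * norm u ^ j"]
      by (simp add: norm_mult norm_power)
    ultimately have "norm (A' n u - a n k) \<le> norm u * (1 / (1 - norm u))"
      by (rule norm_sums_le)
    also have "\<dots> \<le> norm u * 2"
      using u by (intro mult_left_mono) (auto simp: field_simps)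
    finally show ?thesis by simp
  qed
  have "(B' \<longlongrightarrow> b (0 + k)) (at 0)"
    unfolding B'_def by (rule powser_limit_0_strong[of 1], simp, rule shift[OF B])
  hence B'_lim: "(B' \<longlongrightarrow> b k) (at 0)" by simp
  have A'_lim: "(\<lambda>n. A' n u) \<longlonglongrightarrow> B' u" if "u \<noteq> 0" "norm u < 1" for u
    unfolding A'_def B'_def using that less.IH
    by (intro tendsto_intros lim) auto
  show ?case
  proof (rule LIMSEQ_I)
    fix e :: real assume e: "e > 0"
    have "eventually (\<lambda>u. norm (B' u - b k) < e / 3) (at 0)"
      using tendstoD[OF B'_lim, of "e / 3"] e by (simp add: dist_norm)
    moreover have "eventually (\<lambda>u :: complex. norm u < min (1 / 2) (e / 6)) (at 0)"
      using e by (auto simp: eventually_at dist_norm intro!: exI[of _ "min (1 / 2) (e / 6)"])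
    moreover have "eventually (\<lambda>u :: complex. u \<noteq> 0) (at 0)"
      by (simp add: eventually_at_filter)
    ultimately have "eventually (\<lambda>u. norm (B' u - b k) < e / 3 \<and> norm u < min (1 / 2) (e / 6) \<and> u \<noteq> 0) (at 0)"
      by eventually_elim auto
    then obtain u where u: "norm (B' u - b k) < e / 3" "norm u < min (1 / 2) (e / 6)" "u \<noteq> 0"
      using eventually_happens'[OF at_neq_bot] by blast
    have "(\<lambda>n. A' n u) \<longlonglongrightarrow> B' u" using u by (intro A'_lim) auto
    then obtain N where N: "\<And>n. n \<ge> N \<Longrightarrow> norm (A' n u - B' u) < e / 3"
      using LIMSEQ_D[of "\<lambda>n. A' n u" "B' u" "e / 3"] e by auto
    have "norm (a n k - b k) < e" if "n \<ge> N" for n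
    proof -
      have "norm (A' n u - a n k) < e / 3" using close[where u = u and n = n] u by auto
      hence "norm (a n k - A' n u) < e / 3" by (simp add: norm_minus_commute)
      have "a n k - b k = (a n k - A' n u) + (A' n u - B' u) + (B' u - b k)" by simp
      hence "norm (a n k - b k) \<le> norm (a n k - A' n u) + norm (A' n u - B' u) + norm (B' u - b k)"
        by (metis norm_triangle_ineq norm_triangle_mono order_refl)
      with \<open>norm (a n k - A' n u) < e / 3\<close> N[OF that] u(1) show ?thesis by linarith
    qed
    thus "\<exists>N. \<forall>n\<ge>N. norm (a n k - b k) < e" by blast
  qed
qed

section \<open>The limit law\<close>

text \<open>
  The limits of the coefficients are the Taylor coefficients of \<open>q\<close>; as limits of real numbers they
  are real.
\<close>

theorem theorem19:
  "\<exists>p :: nat \<Rightarrow> real.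
     (\<forall>k. (\<lambda>n. prob_fixpoints n k) \<longlonglongrightarrow> p k) \<and>
     (\<forall>u :: complex. (\<lambda>k. of_real (p k) * u ^ k) sums
        exp (1 / 2 * (u - 1) * (u + 4 * of_real (exp 1) - 7)))"
proof -
  define q :: "complex \<Rightarrow> complex" where "q u = exp (1 / 2 * (u - 1) * (u + 4 * of_real (exp 1) - 7))" for u
  define b where "b = fps_nth (fps_expansion q 0)"
  have hol: "q holomorphic_on S" for S
    unfolding q_def by (intro holomorphic_intros)
  have exp: "q has_fps_expansion fps_expansion q 0"
    by (rule has_fps_expansion_fps_expansion[of UNIV]) (auto intro: hol)
  have sums: "(\<lambda>k. b k * u ^ k) sums q u" for u
    unfolding b_def by (rule has_fps_expansion_imp_sums_complex[OF exp hol, of _ \<infinity>]) simp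
  have lim: "(\<lambda>n. complex_of_real (prob_fixpoints n k)) \<longlonglongrightarrow> b k" for k
  proof (rule coefficient_tendsto[where a = "\<lambda>n k. of_real (prob_fixpoints n k)" and b = b
        and A = "\<lambda>n u. fixpoint_mean u n" and B = q])
    show "norm (complex_of_real (prob_fixpoints n k)) \<le> 1" for n k
      by (simp add: prob_fixpoints_def)
    show "(\<lambda>n. fixpoint_mean u n) \<longlonglongrightarrow> q u" for u
      unfolding q_def by (rule fixpoint_mean_tendsto)
  qed (rule prob_fixpoints_sums sums)+
  have Re: "(\<lambda>n. prob_fixpoints n k) \<longlonglongrightarrow> Re (b k)" for k
    using tendsto_Re[OF lim[of k]] by simp
  have "Im (b k) = 0" for k
    using tendsto_Im[OF lim[of k]] by (simp add: LIMSEQ_const_iff)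
  hence "of_real (Re (b k)) = b k" for k by (simp add: complex_eq_iff)
  with Re sums show ?thesis unfolding q_def by (intro exI[of _ "\<lambda>k. Re (b k)"]) simp
qed

end
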